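(* Let $\mathcal{C}$ be a Type II $\mathbb{Z}_4$-code of length $n$ with minimum Euclidean weight $16$. Let $a\in\mathbb{Z}_2^n$ be a vector of weight $4$ not in the residue code $\mathcal{C}_1$, such that the code $\langle\mathcal{C}_1,a\rangle_{\mathbb{Z}_2}$ generated by $\mathcal{C}_1$ and $a$ is doubly even. Then there exists a Type II $\mathbb{Z}_4$-code $\mathcal{C}'$ (of length $n$) such that the minimum Euclidean weight of $\mathcal{C}'$ is $16$, $\mathcal{C}'_1=\langle\mathcal{C}_1,a\rangle_{\mathbb{Z}_2}$, and $A_4(\mathcal{C}')$ is a neighbor of $A_4(\mathcal{C})$.
   Context: A binary code is doubly even if all its codeword weights (numbers of nonzero coordinates) are divisible by $4$. A $\mathbb{Z}_4$-code of length $n$ is a $\mathbb{Z}_4$-submodule $\mathcal{C}\subset\mathbb{Z}_4^n$; it is self-dual if it equals its dual with respect to the standard inner product. Its residue code is $\mathcal{C}_1=\{\alpha\bmod 2\mid\alpha\in\mathcal{C}\}\subset\mathbb{Z}_2^n$. The Euclidean weight of $x\in\mathbb{Z}_4^n$ is $n_1(x)+4n_2(x)+n_3(x)$, where $n_j(x)$ is the number of coordinates equal to $j$; the minimum Euclidean weight of $\mathcal{C}$ is the smallest Euclidean weight of a nonzero codeword. $\mathcal{C}$ is Type II if it is self-dual and all Euclidean weights of its codewords are divisible by $8$. For a self-orthogonal $\mathbb{Z}_4$-code $\mathcal{C}$ of length $n$, define the lattice $A_4(\mathcal{C})=\frac12\{(x_1,\dots,x_n)\in\mathbb{Z}^n\mid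 (x_1\bmod 4,\dots,x_n\bmod 4)\in\mathcal{C}\}\subset\mathbb{R}^n$. Two lattices $L,L'$ are neighbors if both contain a sublattice of index $2$ in common. *)

theory Defs
  imports "HOL-Analysis.Analysis" "HOL-Library.Numeral_Type" "HOL-Library.Z2"
begin

text \<open>
  The ring of integers modulo 4 is the numeral type \<open>4\<close> of HOL-Library.Numeral_Type; the reduction
  of an integer modulo 4 is \<^term>\<open>of_int\<close> at that type. The two-element field is \<^typ>\<open>bit\<close>.
  Coordinates are indexed by a finite type, whose cardinality is the length of a code.
\<close>

type_synonym z4 = "4"

interpretation z4: module "(*s) :: z4 \<Rightarrow> z4 ^ 'n \<Rightarrow> z4 ^ 'n"
  by unfold_locales (simp_all add: vec_eq_iff algebra_simps)

definition weight :: "bit ^ 'n \<Rightarrow> nat" where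
  "weight x = card {i. x $ i \<noteq> 0}"

definition doubly_even :: "(bit ^ 'n) set \<Rightarrow> bool" where
  "doubly_even B \<longleftrightarrow> (\<forall>x\<in>B. 4 dvd weight x)"

definition z4_dual :: "(z4 ^ 'n) set \<Rightarrow> (z4 ^ 'n) set" where
  "z4_dual C = {y. \<forall>x\<in>C. (\<Sum>i\<in>UNIV. x $ i * y $ i) = 0}"

definition z4_self_dual :: "(z4 ^ 'n) set \<Rightarrow> bool" where
  "z4_self_dual C \<longleftrightarrow> C = z4_dual C"

definition euclidean_weight :: "z4 ^ 'n \<Rightarrow> nat" where
  "euclidean_weight x = card {i. x $ i = 1} + 4 * card {i. x $ i = 2} + card {i. x $ i = 3}"

text \<open>The junk value, for a code without nonzero codewords, is \<^term>\<open>Inf {} = (0 :: nat)\<close>.\<close>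

definition min_euclidean_weight :: "(z4 ^ 'n) set \<Rightarrow> nat" where
  "min_euclidean_weight C = Inf (euclidean_weight ` (C - {0}))"

definition type_II :: "(z4 ^ 'n) set \<Rightarrow> bool" where
  "type_II C \<longleftrightarrow> z4.subspace C \<and> z4_self_dual C \<and> (\<forall>x\<in>C. 8 dvd euclidean_weight x)"

text \<open>\<^const>\<open>Rep_bit0\<close> yields the representative of a residue modulo 4 in \<open>{0..<4}\<close>.\<close>

definition mod2 :: "z4 \<Rightarrow> bit" where
  "mod2 x = of_int (Rep_bit0 x)"

lemma mod2_of_int: "mod2 (of_int k) = of_int k"
proof -
  have "(of_int (4 * (k div 4) + k mod 4) :: bit) = of_int (k mod 4)"
    unfolding of_int_add of_int_mult by simp
  moreover have "Rep_bit0 (of_int k :: z4) = k mod 4"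
    using bit0.Rep_Abs_mod[of k, where ?'a = "2"] by (simp add: bit0.of_int_eq)
  ultimately show ?thesis
    by (simp add: mod2_def)
qed

definition residue_code :: "(z4 ^ 'n) set \<Rightarrow> (bit ^ 'n) set" where
  "residue_code C = (\<lambda>x. \<chi> i. mod2 (x $ i)) ` C"

definition A4 :: "(z4 ^ 'n) set \<Rightarrow> (real ^ 'n) set" where
  "A4 C = {(1/2) *\<^sub>R (\<chi> i. real_of_int (x $ i)) | x :: int ^ 'n. (\<chi> i. of_int (x $ i)) \<in> C}"

text \<open>A lattice is a discrete subgroup of full rank.\<close>

definition is_lattice :: "(real ^ 'n) set \<Rightarrow> bool" where
  "is_lattice L \<longleftrightarrow>
     0 \<in> L \<and> (\<forall>x\<in>L. \<forall>y\<in>L. x - y \<in> L) \<and> discrete L \<and> span L = UNIV"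

definition has_index :: "(real ^ 'n) set \<Rightarrow> (real ^ 'n) set \<Rightarrow> nat \<Rightarrow> bool" where
  "has_index L M k \<longleftrightarrow>
     finite ((\<lambda>x. (+) x ` M) ` L) \<and> card ((\<lambda>x. (+) x ` M) ` L) = k"

definition neighbor :: "(real ^ 'n) set \<Rightarrow> (real ^ 'n) set \<Rightarrow> bool" where
  "neighbor L L' \<longleftrightarrow> is_lattice L \<and> is_lattice L' \<and>
     (\<exists>M. is_lattice M \<and> M \<subseteq> L \<and> M \<subseteq> L' \<and> has_index L M 2 \<and> has_index L' M 2)"

end

theory Submission
  imports Defs
begin

text \<open>
  Let \<open>w\<close> be the integer vector with entries 0 and 1 that lifts \<open>a\<close>, and let \<open>\<alpha>\<close> be its
  reduction modulo 4. The code wanted is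
  \<open>C' = {c + k\<alpha> | c \<in> C, c \<cdot> \<alpha> = 2k}\<close>.
  The reason is geometric. The vector \<open>w\<close> has norm 4 and lies in \<open>A\<^sub>4(C)\<close>, because \<open>2\<alpha> \<in> C\<close>;
  and \<open>A\<^sub>4(C')\<close> is the image of \<open>A\<^sub>4(C)\<close> under the reflection
  \<open>v \<mapsto> v - (v \<cdot> w / 2) w\<close> in \<open>w\<close>, which moves the lattice because \<open>v \<cdot> w\<close> is odd for
  some of its vectors \<open>v\<close>. Since a reflection is an isometry, the new lattice
  has the same minimum norm, and this is what bounds the weights of \<open>C'\<close> from below: a nonzero
  codeword of \<open>C'\<close> has a lift of norm equal to its Euclidean weight, and reflecting this lift gives
  a nonzero lift of a codeword of \<open>C\<close>, whose norm is at least 16. The weight 16 is attained by \<open>2\<alpha>\<close>.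

  Double evenness of \<open>\<langle>C\<^sub>1, a\<rangle>\<close> makes \<open>a\<close> orthogonal to \<open>C\<^sub>1\<close>, so that \<open>c \<cdot> \<alpha>\<close> is always 0 or 2 and
  \<open>2\<alpha>\<close> lies in the dual of \<open>C\<close>, which is \<open>C\<close>. As \<open>a \<notin> C\<^sub>1\<close>, some binary \<open>b\<close> is orthogonal to
  \<open>C\<^sub>1\<close> but not to \<open>a\<close>; the codeword \<open>t = 2b\<close> of \<open>C\<close> then satisfies \<open>t \<cdot> \<alpha> = 2\<close> and vanishes
  modulo 2. This \<open>t\<close> does three things. It shows that \<open>C\<^sub>0 = {c \<in> C | c \<cdot> \<alpha> = 0}\<close> has
  index 2 in \<open>C\<close>, and \<open>C'\<close> is the union of \<open>C\<^sub>0\<close> and \<open>t + \<alpha> + C\<^sub>0\<close>, so \<open>A\<^sub>4(C\<^sub>0)\<close> is the common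
  sublattice that makes the two lattices neighbors. It yields self-duality of \<open>C'\<close>. And since adding
  \<open>t\<close> changes \<open>c \<cdot> \<alpha>\<close> without changing the residue of \<open>c\<close>, the residues of \<open>C'\<close> fill the
  whole span of \<open>C\<^sub>1\<close> and \<open>a\<close>.
\<close>

section \<open>The standard bilinear form\<close>

definition dot :: "'a::comm_ring_1 ^ 'n \<Rightarrow> 'a ^ 'n \<Rightarrow> 'a" where
  "dot x y = (\<Sum>i\<in>UNIV. x $ i * y $ i)"

lemma dot_commute: "dot x y = dot y x"
  by (simp add: dot_def mult.commute)

lemma dot_add [simp]: "dot (x + y) z = dot x z + dot y z" "dot z (x + y) = dot z x + dot z y"
  by (simp_all add: dot_def algebra_simps sum.distrib)

lemma dot_diff [simp]: "dot (x - y) z = dot x z - dot y z" "dot z (x - y) = dot z x - dot z y"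
  by (simp_all add: dot_def algebra_simps sum_subtractf)

lemma dot_scale [simp]: "dot (k *s x) z = k * dot x z" "dot z (k *s x) = k * dot z x"
  by (simp_all add: dot_def algebra_simps sum_distrib_left)

lemma dot_zero [simp]: "dot 0 z = 0" "dot z 0 = 0"
  by (simp_all add: dot_def)

lemma dot_self_eq_0_iff: "dot v v = 0 \<longleftrightarrow> v = 0" for v :: "int ^ 'n"
  by (simp add: dot_def sum_nonneg_eq_0_iff vec_eq_iff)

lemma dot_reflection:
  fixes v w :: "int ^ 'n"
  assumes "dot w w = 4" "dot v w = 2 * m"
  shows "dot (v - m *s w) (v - m *s w) = dot v v"
  using assms by (simp add: dot_commute[of w v])

text \<open>
  This is the part of \<open>V = V\<^sup>\<bottom>\<^sup>\<bottom>\<close> that the construction needs: the dot product represents the linear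
  functional that kills a basis of \<open>V\<close> and sends \<open>a\<close> to 1.
\<close>

lemma separating_vector:
  fixes a :: "'a::field ^ 'n"
  assumes "vec.subspace V" "a \<notin> V"
  obtains b where "\<And>x. x \<in> V \<Longrightarrow> dot b x = 0" "dot b a = 1"
proof -
  obtain B where B: "B \<subseteq> V" "vec.independent B" "V \<subseteq> vec.span B"
    using vec.maximal_independent_subset by blast
  have "vec.span B \<subseteq> V"
    using B(1) assms(1) by (simp add: vec.span_minimal)
  then have "a \<notin> vec.span B" and "a \<notin> B"
    using assms(2) vec.span_base by blast+
  with B(2) have "vec.independent (insert a B)"
    by (simp add: vec.independent_insert)
  then obtain g :: "'a ^ 'n \<Rightarrow> 'a ^ 'n" where g: "Vector_Spaces.linear (*s) (*s) g"
    "\<forall>x\<in>insert a B. g x = (if x = a then 1 else 0)"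
    using vec.linear_independent_extend[of "insert a B" "\<lambda>x. if x = a then 1 else 0"] by blast
  interpret g: Vector_Spaces.linear "(*s)" "(*s)" g by (rule g(1))
  \<comment> \<open>\<open>g\<close> sends \<open>a\<close> to the all-one vector, so any coordinate of \<open>g\<close> is the functional wanted.\<close>
  define j :: 'n where "j = undefined"
  define b where "b = (\<chi> i. g (axis i 1) $ j)"
  have dot_b: "dot b x = g x $ j" for x
  proof -
    have "g x = g (\<Sum>i\<in>UNIV. x $ i *s axis i 1)"
      by (simp only: basis_expansion)
    also have "\<dots> = (\<Sum>i\<in>UNIV. x $ i *s g (axis i 1))"
      by (simp only: g.sum g.scale)
    finally have "g x $ j = (\<Sum>i\<in>UNIV. x $ i * g (axis i 1) $ j)"
      by simp
    then show ?thesis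
      by (simp only: dot_def b_def vec_lambda_beta mult.commute)
  qed
  have "g x = 0" if "x \<in> V" for x
  proof (rule vec.linear_eq_0_on_span[OF g(1)])
    show "x \<in> vec.span B" using that B(3) by blast
    show "g y = 0" if "y \<in> B" for y using that g(2) \<open>a \<notin> B\<close> by auto
  qed
  then show ?thesis
    using that[of b] g(2) by (simp add: dot_b)
qed

section \<open>Arithmetic modulo 4 and modulo 2\<close>

lemma of_int_z4_eq_0_iff: "(of_int k :: z4) = 0 \<longleftrightarrow> 4 dvd k"
  using of_int_eq_0_iff_char_dvd[where 'a = z4, of k] by simp

lemma of_int_z4_eq_2_iff: "(of_int k :: z4) = 2 \<longleftrightarrow> k mod 4 = 2"
  using of_int_z4_eq_0_iff[of "k - 2"] by (auto simp: mod_eq_dvd_iff[of k 4 2, simplified])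

lemma z4_four [simp]: "(4 :: z4) = 0"
  by simp

lemma z4_four_mult: "2 * (2 * x) = (0 :: z4)"
  by (simp add: mult.assoc[symmetric])

lemma z4_lift: obtains k where "x = (of_int k :: z4)"
  by (cases x rule: bit0.cases) auto

lemma z4_cases:
  fixes x :: z4
  obtains "x = 0" | "x = 1" | "x = 2" | "x = 3"
proof -
  obtain z where "x = of_int z" "0 \<le> z" "z < 4"
    by (cases x rule: bit0.cases) auto
  then have "z = 0 \<or> z = 1 \<or> z = 2 \<or> z = 3" by auto
  with \<open>x = of_int z\<close> show ?thesis using that by auto
qed

lemma z4_twice_eq_0_iff: "2 * x = 0 \<longleftrightarrow> (\<exists>k. x = 2 * k)" for x :: z4
proof -
  have "2 * (2 * k) = 0" for k :: z4 by (cases k rule: z4_cases) simp_all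
  moreover have "2 * x = 0 \<Longrightarrow> x = 2 * 0 \<or> x = 2 * 1" by (cases x rule: z4_cases) simp_all
  ultimately show ?thesis by blast
qed

lemma z4_even_or_odd: "(\<exists>l. k = 2 * l) \<or> (\<exists>l. k = 1 + 2 * l)" for k :: z4
proof -
  have "k = 2 * 0 \<or> k = 1 + 2 * 0 \<or> k = 2 * 1 \<or> k = 1 + 2 * 1"
    by (cases k rule: z4_cases) simp_all
  then show ?thesis by blast
qed

lemma mod2_add: "mod2 (x + y) = mod2 x + mod2 y"
  by (metis mod2_of_int of_int_add z4_lift)

lemma mod2_mult: "mod2 (x * y) = mod2 x * mod2 y"
  by (metis mod2_of_int of_int_mult z4_lift)

lemma mod2_0 [simp]: "mod2 0 = 0" and mod2_1 [simp]: "mod2 1 = 1" and mod2_2 [simp]: "mod2 2 = 0"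
  using mod2_of_int[of 0] mod2_of_int[of 1] mod2_of_int[of 2] by simp_all

lemma mod2_sum: "mod2 (sum f A) = (\<Sum>i\<in>A. mod2 (f i))"
  by (induction A rule: infinite_finite_induct) (simp_all add: mod2_add)

lemma mod2_eq_0_iff: "mod2 x = 0 \<longleftrightarrow> 2 * x = 0"
proof -
  have "mod2 3 = 1" using mod2_add[of 1 2] by simp
  then show ?thesis by (cases x rule: z4_cases) simp_all
qed

definition red4 :: "int ^ 'n \<Rightarrow> z4 ^ 'n" where
  "red4 v = (\<chi> i. of_int (v $ i))"

lemma red4_simps [simp]:
  "red4 0 = 0" "red4 (u + v) = red4 u + red4 v" "red4 (u - v) = red4 u - red4 v"
  "red4 (k *s v) = of_int k *s red4 v"
  by (simp_all add: red4_def vec_eq_iff)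

lemma dot_red4: "dot (red4 u) (red4 v) = of_int (dot u v)"
  by (simp add: dot_def red4_def)

lemma red4_lift:
  fixes x :: "z4 ^ 'n"
  obtains v where "x = red4 v"
proof -
  have "\<forall>i. \<exists>k. x $ i = of_int k" by (metis z4_lift)
  then obtain f where "\<forall>i. x $ i = of_int (f i)" by metis
  then show ?thesis using that[of "\<chi> i. f i"] by (simp add: red4_def vec_eq_iff)
qed

definition residue :: "z4 ^ 'n \<Rightarrow> bit ^ 'n" where
  "residue x = (\<chi> i. mod2 (x $ i))"

lemma residue_code_eq: "residue_code C = residue ` C"
  by (simp add: residue_code_def residue_def)

lemma residue_simps [simp]:
  "residue 0 = 0" "residue (x + y) = residue x + residue y" "residue (k *s x) = mod2 k *s residue x"
  by (simp_all add: residue_def vec_eq_iff mod2_add mod2_mult)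

lemma dot_residue: "dot (residue x) (residue y) = mod2 (dot x y)"
  by (simp add: dot_def residue_def mod2_sum mod2_mult)

lemma subspace_residue_code:
  assumes "z4.subspace C"
  shows "vec.subspace (residue_code C)"
proof (rule vec.subspaceI)
  show "0 \<in> residue_code C"
    using z4.subspace_0[OF assms] unfolding residue_code_eq by (metis imageI residue_simps(1))
  show "x + y \<in> residue_code C" if "x \<in> residue_code C" "y \<in> residue_code C" for x y
    using that z4.subspace_add[OF assms] unfolding residue_code_eq
    by (auto simp flip: residue_simps(2))
  show "k *s x \<in> residue_code C" if "x \<in> residue_code C" for k x
    using that \<open>0 \<in> residue_code C\<close> by (cases k) auto
qed

text \<open>
  The supports satisfy \<open>wt(x + y) + 2 |X \<inter> Y| = wt(x) + wt(y)\<close>, so \<open>|X \<inter> Y|\<close> is even.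
\<close>

lemma doubly_even_orthogonal:
  fixes x y :: "bit ^ 'n"
  assumes "doubly_even B" "x \<in> B" "y \<in> B" "x + y \<in> B"
  shows "dot x y = 0"
proof -
  let ?m = "\<Sum>i\<in>UNIV. of_bool (x $ i \<noteq> 0 \<and> y $ i \<noteq> 0) :: nat"
  have weight: "weight z = (\<Sum>i\<in>UNIV. of_bool (z $ i \<noteq> 0))" for z :: "bit ^ 'n"
    by (simp add: weight_def)
  have "of_bool (p + q \<noteq> 0) + 2 * of_bool (p \<noteq> 0 \<and> q \<noteq> 0)
      = (of_bool (p \<noteq> 0) + of_bool (q \<noteq> 0) :: nat)" for p q :: bit
    by (cases p; cases q) simp_all
  then have "weight (x + y) + 2 * ?m = weight x + weight y"
    unfolding weight sum_distrib_left sum.distrib[symmetric] by simp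
  moreover have "4 dvd weight (x + y)" "4 dvd weight x" "4 dvd weight y"
    using assms by (auto simp: doubly_even_def)
  ultimately have "even ?m" by presburger
  then obtain l where "?m = 2 * l" by blast
  have "p * q = of_nat (of_bool (p \<noteq> 0 \<and> q \<noteq> 0))" for p q :: bit
    by (cases p; cases q) simp_all
  then have "dot x y = of_nat ?m"
    unfolding dot_def of_nat_sum by simp
  also have "\<dots> = 0" unfolding \<open>?m = 2 * l\<close> by simp
  finally show ?thesis .
qed

section \<open>Euclidean weights and norms of integer lifts\<close>

definition coordinate_weight :: "z4 \<Rightarrow> nat" where
  "coordinate_weight z = (if z = 0 then 0 else if z = 2 then 4 else 1)"

lemma euclidean_weight_eq_sum:
  "euclidean_weight x = (\<Sum>i\<in>UNIV. coordinate_weight (x $ i))"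
proof -
  have "coordinate_weight z = of_bool (z = 1) + 4 * of_bool (z = 2) + of_bool (z = 3)" for z
    by (cases z rule: z4_cases) (simp_all add: coordinate_weight_def)
  then show ?thesis
    by (simp add: euclidean_weight_def sum.distrib flip: sum_distrib_left)
qed

text \<open>
  The square of an integer is congruent modulo 8 to the weight of its residue modulo 4 and never
  smaller, so Euclidean weights can be studied through norms of integer lifts.
\<close>

lemma
  fixes v :: "int ^ 'n"
  shows euclidean_weight_red4_le: "int (euclidean_weight (red4 v)) \<le> dot v v"
    and euclidean_weight_red4_dvd: "8 dvd dot v v - int (euclidean_weight (red4 v))"
proof -
  let ?e = "\<lambda>z. int (coordinate_weight z)"
  have e: "?e (of_int k) \<le> k * k \<and> 8 dvd k * k - ?e (of_int k)" for k
  proof -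
    define q where "q = k div 4"
    have k: "k = 4 * q + k mod 4" by (simp add: q_def)
    have sq: "1 \<le> m * m" if "m \<noteq> 0" for m :: int
      using that zero_le_square[of m] mult_eq_0_iff[of m m] by linarith
    have "k mod 4 = 0 \<or> k mod 4 = 1 \<or> k mod 4 = 2 \<or> k mod 4 = 3" by presburger
    then consider "k = 4 * q" | "k = 4 * q + 1" | "k = 4 * q + 2" | "k = 4 * q + 3"
      using k by (elim disjE) auto
    then show ?thesis
    proof cases
      case 1
      have "k * k - 0 = 8 * (2 * q * q)" using 1 by algebra
      moreover have "(of_int k :: z4) = 0" unfolding of_int_z4_eq_0_iff using 1 by simp
      ultimately show ?thesis by (simp add: coordinate_weight_def)
    next
      case 2
      have "k * k - 1 = 8 * (2 * q * q + q)" using 2 by algebra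
      moreover have "(of_int k :: z4) \<noteq> 0" "(of_int k :: z4) \<noteq> 2"
        unfolding of_int_z4_eq_0_iff of_int_z4_eq_2_iff using 2 by presburger+
      moreover have "1 \<le> k * k" by (rule sq) (use 2 in presburger)
      ultimately show ?thesis by (simp add: coordinate_weight_def)
    next
      case 3
      have "k * k - 4 = 8 * (2 * q * q + 2 * q)" using 3 by algebra
      moreover have "(of_int k :: z4) \<noteq> 0" "(of_int k :: z4) = 2"
        unfolding of_int_z4_eq_0_iff of_int_z4_eq_2_iff using 3 by presburger+
      moreover have "k * k = 4 * ((2 * q + 1) * (2 * q + 1))" using 3 by algebra
      moreover have "1 \<le> (2 * q + 1) * (2 * q + 1)" by (rule sq) presburger
      ultimately have "4 \<le> k * k" "8 dvd k * k - 4" "(of_int k :: z4) \<noteq> 0" "(of_int k :: z4) = 2"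
        by simp_all
      then show ?thesis by (simp add: coordinate_weight_def)
    next
      case 4
      have "k * k - 1 = 8 * (2 * q * q + 3 * q + 1)" using 4 by algebra
      moreover have "(of_int k :: z4) \<noteq> 0" "(of_int k :: z4) \<noteq> 2"
        unfolding of_int_z4_eq_0_iff of_int_z4_eq_2_iff using 4 by presburger+
      moreover have "1 \<le> k * k" by (rule sq) (use 4 in presburger)
      ultimately show ?thesis by (simp add: coordinate_weight_def)
    qed
  qed
  have w: "int (euclidean_weight (red4 v)) = (\<Sum>i\<in>UNIV. ?e (of_int (v $ i)))"
    by (simp add: euclidean_weight_eq_sum red4_def)
  show "int (euclidean_weight (red4 v)) \<le> dot v v"
    unfolding w dot_def by (rule sum_mono) (use e in blast)
  show "8 dvd dot v v - int (euclidean_weight (red4 v))"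
    unfolding w dot_def sum_subtractf[symmetric] by (rule dvd_sum) (use e in blast)
qed

lemma minimal_lift:
  fixes x :: "z4 ^ 'n"
  obtains v where "red4 v = x" "dot v v = int (euclidean_weight x)"
proof -
  have minus: "(- 1 :: z4) = 3" by (rule minus_unique) simp
  have "\<exists>k. of_int k = z \<and> k * k = int (coordinate_weight z)" for z
  proof (cases z rule: z4_cases)
    case 1 then show ?thesis by (intro exI[of _ 0]) (simp add: coordinate_weight_def)
  next
    case 2 then show ?thesis by (intro exI[of _ 1]) (simp add: coordinate_weight_def)
  next
    case 3 then show ?thesis by (intro exI[of _ 2]) (simp add: coordinate_weight_def)
  next
    case 4 then show ?thesis by (intro exI[of _ "- 1"]) (simp add: coordinate_weight_def minus)
  qed
  then obtain f where f: "\<And>z. of_int (f z) = z" "\<And>z. f z * f z = int (coordinate_weight z)"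
    by metis
  show ?thesis
  proof (rule that)
    show "red4 (\<chi> i. f (x $ i)) = x" by (simp add: red4_def f(1))
    show "dot (\<chi> i. f (x $ i)) (\<chi> i. f (x $ i)) = int (euclidean_weight x)"
      by (simp add: dot_def euclidean_weight_eq_sum f(2))
  qed
qed

lemma min_euclidean_weight_eqI:
  assumes "\<And>x. x \<in> C \<Longrightarrow> x \<noteq> 0 \<Longrightarrow> d \<le> euclidean_weight x"
    and "z \<in> C" "z \<noteq> 0" "euclidean_weight z = d"
  shows "min_euclidean_weight C = d"
  unfolding min_euclidean_weight_def by (rule cInf_eq_minimum) (use assms in auto)

lemma min_euclidean_weight_le:
  assumes "x \<in> C" "x \<noteq> 0"
  shows "min_euclidean_weight C \<le> euclidean_weight x"
  unfolding min_euclidean_weight_def by (rule cInf_lower) (use assms in auto)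

text \<open>
  In the scale of \<open>A4\<close> this says that the minimum norm of the lattice is at least 4. A nonzero
  vector over the zero codeword has an entry that is a nonzero multiple of 4, hence norm at least
  \<open>4\<^sup>2\<close>.
\<close>

lemma lift_norm_ge_16:
  fixes v :: "int ^ 'n"
  assumes "\<And>x. x \<in> C \<Longrightarrow> x \<noteq> 0 \<Longrightarrow> 16 \<le> euclidean_weight x"
    and "red4 v \<in> C" "v \<noteq> 0"
  shows "16 \<le> dot v v"
proof (cases "red4 v = 0")
  case False
  then have "16 \<le> euclidean_weight (red4 v)" using assms(1,2) by blast
  then show ?thesis using euclidean_weight_red4_le[of v] by linarith
next
  case True
  obtain i where i: "v $ i \<noteq> 0" using assms(3) by (auto simp: vec_eq_iff)
  have "(of_int (v $ i) :: z4) = 0" using True by (simp add: red4_def vec_eq_iff)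
  then have "4 \<le> \<bar>v $ i\<bar>"
    using i dvd_imp_le_int unfolding of_int_z4_eq_0_iff by fastforce
  then have "16 \<le> v $ i * v $ i"
    using mult_mono[of 4 "\<bar>v $ i\<bar>" 4 "\<bar>v $ i\<bar>"] by simp
  also have "\<dots> \<le> dot v v"
    unfolding dot_def by (rule member_le_sum) auto
  finally show ?thesis .
qed

section \<open>The lattices of codes\<close>

definition half :: "int ^ 'n \<Rightarrow> real ^ 'n" where
  "half v = (1/2) *\<^sub>R (\<chi> i. real_of_int (v $ i))"

lemma half_diff [simp]: "half (u - v) = half u - half v"
  by (simp add: half_def vec_eq_iff algebra_simps)

lemma half_eq_iff: "half u = half v \<longleftrightarrow> u = v"
  by (simp add: half_def vec_eq_iff)

lemma A4_eq: "A4 C = half ` {v. red4 v \<in> C}"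
  by (auto simp: A4_def red4_def half_def)

lemma half_in_A4_iff: "half v \<in> A4 C \<longleftrightarrow> red4 v \<in> C"
  by (auto simp: A4_eq half_eq_iff)

lemma A4_diff:
  assumes "z4.subspace C" "x \<in> A4 C" "y \<in> A4 C"
  shows "x - y \<in> A4 C"
proof -
  obtain u v where "x = half u" "red4 u \<in> C" "y = half v" "red4 v \<in> C"
    using assms(2,3) unfolding A4_eq by blast
  then show ?thesis
    using z4.subspace_diff[OF assms(1)] by (simp add: half_in_A4_iff flip: half_diff)
qed

lemma zero_in_A4:
  assumes "z4.subspace C"
  shows "0 \<in> A4 C"
proof -
  have "half 0 \<in> A4 C" using z4.subspace_0[OF assms] by (simp add: half_in_A4_iff)
  moreover have "half (0 :: int ^ 'a) = 0" by (simp add: half_def vec_eq_iff)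
  ultimately show ?thesis by simp
qed

text \<open>
  The lattice lies between \<open>2\<int>\<^sup>n\<close>, which has full rank, and \<open>(1/2)\<int>\<^sup>n\<close>, which is discrete.
\<close>

lemma is_lattice_A4:
  fixes C :: "(z4 ^ 'n) set"
  assumes "z4.subspace C"
  shows "is_lattice (A4 C)"
  unfolding is_lattice_def
proof (intro conjI ballI)
  show "0 \<in> A4 C" using zero_in_A4[OF assms] .
  show "x - y \<in> A4 C" if "x \<in> A4 C" "y \<in> A4 C" for x y
    using A4_diff[OF assms that] .
  have "uniform_discrete (A4 C)"
  proof (rule uniformI2[of "1/2"])
    fix x y assume "x \<in> A4 C" "y \<in> A4 C" "x \<noteq> y"
    then obtain u v where uv: "x = half u" "y = half v" "u \<noteq> v" unfolding A4_eq by blast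
    then obtain i where "u $ i \<noteq> v $ i" by (auto simp: vec_eq_iff)
    then have "1 \<le> \<bar>u $ i - v $ i\<bar>" by linarith
    then have "1 \<le> \<bar>real_of_int (u $ i - v $ i)\<bar>" by linarith
    moreover have "(x - y) $ i = real_of_int (u $ i - v $ i) / 2"
      by (simp add: uv half_def diff_divide_distrib)
    ultimately have "1/2 \<le> \<bar>(x - y) $ i\<bar>" by (simp only: abs_divide) simp
    also have "\<dots> \<le> dist x y" unfolding dist_norm by (rule component_le_norm_cart)
    finally show "1/2 \<le> dist x y" .
  qed simp
  then show "discrete (A4 C)" by (rule uniform_discrete_imp_discrete)
  have axis: "axis i 1 \<in> span (A4 C)" for i
  proof -
    have "red4 (axis i 4) = (0 :: z4 ^ 'n)" by (simp add: red4_def axis_def vec_eq_iff)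
    then have "half (axis i 4) \<in> A4 C"
      using z4.subspace_0[OF assms] by (simp add: half_in_A4_iff)
    then have "(1/2) *\<^sub>R half (axis i 4) \<in> span (A4 C)"
      by (intro span_scale span_base)
    moreover have "(1/2) *\<^sub>R half (axis i 4) = axis i 1"
      by (simp add: half_def axis_def vec_eq_iff)
    ultimately show ?thesis by simp
  qed
  have "x \<in> span (A4 C)" for x
  proof -
    have "(\<Sum>i\<in>UNIV. x $ i *s axis i 1) \<in> span (A4 C)"
      unfolding scalar_mult_eq_scaleR by (intro span_sum span_scale axis)
    then show ?thesis by (simp add: basis_expansion)
  qed
  then show "span (A4 C) = UNIV" by blast
qed

lemma has_index_2I:
  assumes M: "0 \<in> M" "\<And>x y. x \<in> M \<Longrightarrow> y \<in> M \<Longrightarrow> x - y \<in> M" and "M \<subseteq> L"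
    and t: "t \<in> L" "t \<notin> M" and L: "\<And>x. x \<in> L \<Longrightarrow> x \<in> M \<or> x - t \<in> M"
  shows "has_index L M 2"
proof -
  have neg: "- x \<in> M" if "x \<in> M" for x using M(2)[OF M(1) that] by simp
  have add: "x + y \<in> M" if "x \<in> M" "y \<in> M" for x y using M(2)[OF that(1) neg[OF that(2)]] by simp
  have coset: "(+) x ` M = (+) y ` M" if "x - y \<in> M" for x y
  proof (intro equalityI subsetI)
    fix z assume "z \<in> (+) x ` M"
    then obtain m where "m \<in> M" "z = x + m" by blast
    then have "z = y + ((x - y) + m)" "(x - y) + m \<in> M" using add that by auto
    then show "z \<in> (+) y ` M" by blast
  next
    fix z assume "z \<in> (+) y ` M"
    then obtain m where "m \<in> M" "z = y + m" by blast
    then have "z = x + (m - (x - y))" "m - (x - y) \<in> M" using M(2) that by auto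
    then show "z \<in> (+) x ` M" by blast
  qed
  have "(\<lambda>x. (+) x ` M) ` L = {(+) 0 ` M, (+) t ` M}"
  proof (intro equalityI subsetI)
    fix K assume "K \<in> (\<lambda>x. (+) x ` M) ` L"
    then obtain x where "x \<in> L" "K = (+) x ` M" by blast
    then show "K \<in> {(+) 0 ` M, (+) t ` M}"
      using L[of x] coset[of x 0] coset[of x t] by auto
  next
    show "K \<in> (\<lambda>x. (+) x ` M) ` L" if "K \<in> {(+) 0 ` M, (+) t ` M}" for K
      using that M(1) \<open>M \<subseteq> L\<close> t(1) by blast
  qed
  moreover have "t \<in> (+) t ` M" using M(1) by force
  then have "(+) 0 ` M \<noteq> (+) t ` M" using t(2) by auto
  ultimately show ?thesis unfolding has_index_def by simp
qed

lemma has_index_A4_2I: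
  fixes C :: "(z4 ^ 'n) set"
  assumes "z4.subspace M" "M \<subseteq> C" "t \<in> C" "t \<notin> M"
    and C: "\<And>x. x \<in> C \<Longrightarrow> x \<in> M \<or> x - t \<in> M"
  shows "has_index (A4 C) (A4 M) 2"
proof -
  obtain \<tau> where \<tau>: "t = red4 \<tau>" using red4_lift .
  show ?thesis
  proof (rule has_index_2I[of _ _ "half \<tau>"])
    show "0 \<in> A4 M" using zero_in_A4[OF assms(1)] .
    show "x - y \<in> A4 M" if "x \<in> A4 M" "y \<in> A4 M" for x y using A4_diff[OF assms(1) that] .
    show "A4 M \<subseteq> A4 C" using assms(2) unfolding A4_eq by blast
    show "half \<tau> \<in> A4 C" "half \<tau> \<notin> A4 M" using assms(3,4) by (simp_all add: half_in_A4_iff \<tau>)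
    show "x \<in> A4 M \<or> x - half \<tau> \<in> A4 M" if "x \<in> A4 C" for x
    proof -
      from that obtain v where v: "x = half v" "red4 v \<in> C" unfolding A4_eq by blast
      then show ?thesis
        using C[OF v(2)] by (simp add: half_in_A4_iff \<tau> flip: half_diff)
    qed
  qed
qed
section \<open>Reflecting a Type II code\<close>

text \<open>
  The weight 4 vector of the theorem enters only through its lift \<open>w\<close>. The codeword \<open>t\<close> witnesses
  that the reflection in \<open>w\<close> moves the lattice; its zero residue lets it be added to any codeword
  without changing the residue.
\<close>

locale odd_reflection =
  fixes C :: "(z4 ^ 'n) set" and w :: "int ^ 'n" and t :: "z4 ^ 'n"
  assumes type_II: "type_II C"
    and norm_w: "dot w w = 4"
    and even_pairing: "\<And>c. c \<in> C \<Longrightarrow> \<exists>k. dot c (red4 w) = 2 * k"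
    and t_in: "t \<in> C" and residue_t: "residue t = 0" and dot_t: "dot t (red4 w) = 2"
begin

abbreviation \<alpha> :: "z4 ^ 'n" where
  "\<alpha> \<equiv> red4 w"

text \<open>
  If \<open>v\<close> is a lift of \<open>c\<close>, then \<open>2k\<close> is the residue of \<open>v \<cdot> w\<close> modulo 4, so the reflection of
  \<open>v\<close> in \<open>w\<close> lifts \<open>c + k\<alpha>\<close> up to a multiple of \<open>2\<alpha>\<close>. Likewise \<open>c\<close> determines \<open>k\<close> only up to
  adding 2. Both ambiguities are harmless: \<open>2\<alpha>\<close> is a codeword of \<open>C\<close> orthogonal to \<open>\<alpha>\<close>.
\<close>

definition reflected :: "(z4 ^ 'n) set" where
  "reflected = {c + k *s \<alpha> | c k. c \<in> C \<and> dot c \<alpha> = 2 * k}"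

definition common :: "(z4 ^ 'n) set" where
  "common = {c \<in> C. dot c \<alpha> = 0}"

lemma subspace: "z4.subspace C"
  using type_II by (simp add: type_II_def)

lemma orthogonal: "x \<in> C \<Longrightarrow> y \<in> C \<Longrightarrow> dot x y = 0"
  using type_II by (auto simp: type_II_def z4_self_dual_def z4_dual_def dot_def)

lemma in_CI: "(\<And>x. x \<in> C \<Longrightarrow> dot x y = 0) \<Longrightarrow> y \<in> C"
  using type_II unfolding type_II_def z4_self_dual_def z4_dual_def dot_def by blast

lemma dot_\<alpha>_\<alpha>: "dot \<alpha> \<alpha> = 0"
  by (simp add: dot_red4 norm_w)

text \<open>As \<open>C\<close> contains its dual, it suffices that every pairing with \<open>\<alpha>\<close> is even.\<close>

lemma even_multiple_in: "(2 * k) *s \<alpha> \<in> C"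
proof (rule in_CI)
  fix x assume "x \<in> C"
  then obtain l where "dot x \<alpha> = 2 * l" using even_pairing by blast
  then show "dot x ((2 * k) *s \<alpha>) = 0" by (simp add: z4_four_mult)
qed

lemma \<alpha>_notin: "\<alpha> \<notin> C"
  using orthogonal[OF t_in] dot_t by auto

lemma double_\<alpha>_neq_0: "2 *s \<alpha> \<noteq> 0"
proof
  assume "2 *s \<alpha> = 0"
  then have "2 * \<alpha> $ i = 0" for i
    by (metis vector_smult_component zero_index)
  then have "\<exists>k. \<alpha> $ i = 2 * k" for i
    unfolding z4_twice_eq_0_iff by blast
  moreover have "2 * t $ i = 0" for i
    using residue_t by (simp add: residue_def vec_eq_iff mod2_eq_0_iff)
  ultimately have "t $ i * \<alpha> $ i = 0" for i
  proof -
    obtain k where "\<alpha> $ i = 2 * k" using \<open>\<And>i. \<exists>k. \<alpha> $ i = 2 * k\<close> by blast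
    then have "t $ i * \<alpha> $ i = k * (2 * t $ i)" by (simp only: mult.commute mult.left_commute)
    then show ?thesis using \<open>\<And>i. 2 * t $ i = 0\<close> by simp
  qed
  then show False using dot_t by (simp add: dot_def)
qed

lemma reflectedI: "c \<in> C \<Longrightarrow> dot c \<alpha> = 2 * k \<Longrightarrow> c + k *s \<alpha> \<in> reflected"
  unfolding reflected_def by blast

lemma reflectedE:
  assumes "y \<in> reflected"
  obtains c k where "y = c + k *s \<alpha>" "c \<in> C" "dot c \<alpha> = 2 * k"
  using assms unfolding reflected_def by blast

lemma subspace_reflected: "z4.subspace reflected"
proof (rule z4.subspaceI)
  show "0 \<in> reflected"
    using reflectedI[of 0 0] z4.subspace_0[OF subspace] by simp
next
  fix x y assume "x \<in> reflected" "y \<in> reflected"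
  then obtain c k d l where "x = c + k *s \<alpha>" "c \<in> C" "dot c \<alpha> = 2 * k"
    "y = d + l *s \<alpha>" "d \<in> C" "dot d \<alpha> = 2 * l" by (elim reflectedE)
  then have "x + y = (c + d) + (k + l) *s \<alpha>" "c + d \<in> C" "dot (c + d) \<alpha> = 2 * (k + l)"
    using z4.subspace_add[OF subspace] by (auto simp: algebra_simps z4.scale_left_distrib)
  then show "x + y \<in> reflected" using reflectedI by metis
next
  fix m x assume "x \<in> reflected"
  then obtain c k where "x = c + k *s \<alpha>" "c \<in> C" "dot c \<alpha> = 2 * k" by (elim reflectedE)
  then have "m *s x = m *s c + (m * k) *s \<alpha>" "m *s c \<in> C" "dot (m *s c) \<alpha> = 2 * (m * k)"
    using z4.subspace_scale[OF subspace] by (auto simp: z4.scale_right_distrib)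
  then show "m *s x \<in> reflected" using reflectedI by metis
qed

lemma reflected_orthogonal:
  assumes "x \<in> reflected" "y \<in> reflected"
  shows "dot x y = 0"
proof -
  obtain c k d l where "x = c + k *s \<alpha>" "c \<in> C" "dot c \<alpha> = 2 * k"
    "y = d + l *s \<alpha>" "d \<in> C" "dot d \<alpha> = 2 * l" using assms by (elim reflectedE)
  then have "dot x y = 4 * (k * l)"
    by (simp add: orthogonal dot_\<alpha>_\<alpha> dot_commute[of \<alpha> d])
  then show ?thesis by simp
qed

lemma common_or_shift: "c \<in> C \<Longrightarrow> c \<in> common \<or> c - t \<in> common"
proof -
  assume c: "c \<in> C"
  then obtain k where "dot c \<alpha> = 2 * k" using even_pairing by blast
  then have "dot c \<alpha> = 0 \<or> dot c \<alpha> = 2" by (cases k rule: z4_cases) simp_all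
  then show ?thesis
    using c t_in dot_t z4.subspace_diff[OF subspace] by (auto simp: common_def)
qed

lemma common_subset: "common \<subseteq> C" "common \<subseteq> reflected"
  using reflectedI[of _ 0] by (auto simp: common_def)

lemma shift_in_reflected: "t + \<alpha> \<in> reflected"
  using reflectedI[of t 1] t_in dot_t by simp

text \<open>
  For \<open>y\<close> in the dual, the shift \<open>z = y - l\<alpha>\<close> is chosen so that it becomes orthogonal not only to the
  common subcode but also to \<open>t\<close>, hence to all of \<open>C\<close>.
\<close>

lemma self_dual_reflected: "z4_self_dual reflected"
  unfolding z4_self_dual_def
proof (intro equalityI subsetI)
  show "y \<in> z4_dual reflected" if "y \<in> reflected" for y
    using that reflected_orthogonal by (auto simp: z4_dual_def simp flip: dot_def)
next
  fix y assume "y \<in> z4_dual reflected"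
  then have y: "dot x y = 0" if "x \<in> reflected" for x
    using that by (auto simp: z4_dual_def simp flip: dot_def)
  have "2 *s t \<in> common"
    using t_in dot_t z4.subspace_scale[OF subspace] by (simp add: common_def)
  then have "2 * dot t y = 0"
    using y common_subset(2) dot_scale(1)[of 2 t y] by (metis subsetD)
  then obtain l where l: "dot t y = 2 * l"
    using z4_twice_eq_0_iff by blast
  have "dot t y + dot \<alpha> y = 0"
    using y[OF shift_in_reflected] by simp
  then have "dot \<alpha> y = - (2 * l)" using l by (simp add: add_eq_0_iff)
  moreover have "4 * l = 0" by simp
  then have "- (2 * l) = 2 * l" by (simp add: eq_neg_iff_add_eq_0)
  ultimately have y_\<alpha>: "dot y \<alpha> = 2 * l" by (simp add: dot_commute)
  define z where "z = y - l *s \<alpha>"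
  have z_t: "dot t z = 0"
    using l dot_t by (simp add: z_def mult.commute)
  have z_common: "dot c z = 0" if "c \<in> common" for c
    using that y common_subset(2) by (auto simp: z_def common_def)
  have "z \<in> C"
  proof (rule in_CI)
    fix c assume "c \<in> C"
    then have "dot c z = 0 \<or> dot (c - t) z = 0" using common_or_shift z_common by blast
    then show "dot c z = 0" using z_t by auto
  qed
  moreover have "dot z \<alpha> = 2 * l" by (simp add: z_def y_\<alpha> dot_\<alpha>_\<alpha>)
  ultimately have "z + l *s \<alpha> \<in> reflected" by (rule reflectedI)
  then show "y \<in> reflected" by (simp add: z_def)
qed

text \<open>
  For lifts \<open>u\<close> of \<open>c\<close> and \<open>\<kappa>\<close> of \<open>k\<close>, the norm of \<open>u + \<kappa>w\<close> is
  \<open>u \<cdot> u + 2\<kappa> (u \<cdot> w) + 4\<kappa>\<^sup>2\<close>; with \<open>u \<cdot> w \<equiv> 2\<kappa>\<close> modulo 4 the last two terms add up to \<open>8\<kappa>\<^sup>2\<close>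
  modulo 8.
\<close>

lemma reflected_weight_dvd:
  assumes "y \<in> reflected"
  shows "8 dvd euclidean_weight y"
proof -
  obtain c k where y: "y = c + k *s \<alpha>" "c \<in> C" "dot c \<alpha> = 2 * k" using assms by (elim reflectedE)
  obtain u where u: "c = red4 u" using red4_lift .
  obtain \<kappa> where \<kappa>: "k = of_int \<kappa>" using z4_lift .
  have "of_int (dot u w) = (of_int (2 * \<kappa>) :: z4)"
    using y(3) by (simp add: u \<kappa> dot_red4)
  then have "(of_int (dot u w - 2 * \<kappa>) :: z4) = 0" by (simp only: of_int_diff) simp
  then obtain j where j: "dot u w = 2 * \<kappa> + 4 * j"
    unfolding of_int_z4_eq_0_iff by (metis add_diff_cancel_left' add_diff_eq dvd_def)
  have "dot (u + \<kappa> *s w) (u + \<kappa> *s w) = dot u u + 8 * (\<kappa> * \<kappa> + \<kappa> * j)"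
    by (simp add: dot_commute[of w u] norm_w j algebra_simps)
  moreover have "8 dvd int (euclidean_weight c)"
    using type_II y(2) unfolding type_II_def by (metis int_dvd_int_iff of_nat_numeral)
  then have "8 dvd dot u u"
    using euclidean_weight_red4_dvd[of u] unfolding u by (simp add: dvd_diff_left_iff)
  ultimately have "8 dvd dot (u + \<kappa> *s w) (u + \<kappa> *s w)"
    by (simp only: dvd_add dvd_triv_left)
  moreover have "8 dvd dot (u + \<kappa> *s w) (u + \<kappa> *s w) - int (euclidean_weight y)"
    using euclidean_weight_red4_dvd[of "u + \<kappa> *s w"] by (simp add: y(1) u \<kappa>)
  ultimately have "8 dvd int (euclidean_weight y)" by (simp add: dvd_diff_right_iff)
  then show ?thesis by (metis int_dvd_int_iff of_nat_numeral)
qed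

lemma type_II_reflected: "type_II reflected"
  using subspace_reflected self_dual_reflected reflected_weight_dvd by (simp add: type_II_def)

text \<open>
  The reflection in \<open>w\<close> takes a lift of a codeword of the new code back to a lift of a codeword of
  \<open>C\<close>, and it preserves norms.
\<close>

lemma reflected_weight_ge_16:
  assumes C: "\<And>x. x \<in> C \<Longrightarrow> x \<noteq> 0 \<Longrightarrow> 16 \<le> euclidean_weight x"
    and "y \<in> reflected" "y \<noteq> 0"
  shows "16 \<le> euclidean_weight y"
proof -
  obtain c k where y: "y = c + k *s \<alpha>" "c \<in> C" "dot c \<alpha> = 2 * k"
    using assms(2) by (elim reflectedE)
  obtain v where v: "red4 v = y" "dot v v = int (euclidean_weight y)" using minimal_lift .
  have "of_int (dot v w) = 2 * k"
    using y(3) by (simp add: v(1) y(1) dot_\<alpha>_\<alpha> flip: dot_red4)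
  then have "of_int (2 * dot v w) = 2 * (2 * k)" by simp
  also have "\<dots> = 0" by (simp add: z4_four_mult)
  finally have "even (dot v w)" unfolding of_int_z4_eq_0_iff by presburger
  then obtain m where m: "dot v w = 2 * m" by blast
  \<comment> \<open>The coefficients \<open>k\<close> and \<open>m\<close> agree modulo 2, so the reflection differs from \<open>c\<close> by an even
    multiple of \<open>\<alpha>\<close>.\<close>
  with \<open>of_int (dot v w) = 2 * k\<close> have "2 * (k - of_int m) = 0" by (simp add: algebra_simps)
  then obtain l where l: "k - of_int m = 2 * l" using z4_twice_eq_0_iff by blast
  let ?s = "v - m *s w"
  have norm: "dot ?s ?s = dot v v" using dot_reflection[OF norm_w m] .
  have "red4 ?s = c + (k - of_int m) *s \<alpha>"
    by (simp add: v(1) y(1) z4.scale_left_diff_distrib)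
  then have "red4 ?s \<in> C"
    using y(2) even_multiple_in z4.subspace_add[OF subspace] by (simp add: l)
  moreover have "?s \<noteq> 0"
  proof
    assume "?s = 0"
    then have "v = 0" using norm dot_self_eq_0_iff by (metis dot_zero(1))
    then show False using v(1) \<open>y \<noteq> 0\<close> by simp
  qed
  ultimately have "16 \<le> dot ?s ?s" using lift_norm_ge_16[of C ?s] C by blast
  then show ?thesis using norm v(2) by simp
qed

lemma min_weight_reflected:
  assumes "min_euclidean_weight C = 16"
  shows "min_euclidean_weight reflected = 16"
proof (rule min_euclidean_weight_eqI)
  have C: "16 \<le> euclidean_weight x" if "x \<in> C" "x \<noteq> 0" for x
    using min_euclidean_weight_le[OF that] assms by simp
  show "16 \<le> euclidean_weight x" if "x \<in> reflected" "x \<noteq> 0" for x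
    using reflected_weight_ge_16[OF C that] .
  have in_C: "2 *s \<alpha> \<in> C" using even_multiple_in[of 1] by simp
  then show "2 *s \<alpha> \<in> reflected"
    using reflectedI[of "2 *s \<alpha>" 0] by (simp add: dot_\<alpha>_\<alpha>)
  show "2 *s \<alpha> \<noteq> 0" by (rule double_\<alpha>_neq_0)
  have "int (euclidean_weight (2 *s \<alpha>)) \<le> 16"
    using euclidean_weight_red4_le[of "2 *s w"] by (simp add: norm_w)
  then show "euclidean_weight (2 *s \<alpha>) = 16"
    using C[OF in_C double_\<alpha>_neq_0] by simp
qed

text \<open>
  A codeword \<open>c\<close> contributes to the new code with one parity of \<open>k\<close> only; replacing \<open>c\<close> by \<open>c + t\<close>
  gives the other parity over the same residue.
\<close>

lemma residue_code_reflected: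
  "residue_code reflected = vec.span (insert (residue \<alpha>) (residue_code C))"
proof (intro equalityI subsetI)
  fix x assume "x \<in> residue_code reflected"
  then obtain y where "y \<in> reflected" "x = residue y" by (auto simp: residue_code_eq)
  then obtain c k where "x = residue c + mod2 k *s residue \<alpha>" "c \<in> C"
    by (auto elim!: reflectedE)
  then show "x \<in> vec.span (insert (residue \<alpha>) (residue_code C))"
    by (auto simp: residue_code_eq intro!: vec.span_add vec.span_scale intro: vec.span_base)
next
  fix x assume "x \<in> vec.span (insert (residue \<alpha>) (residue_code C))"
  then obtain b where "x - b *s residue \<alpha> \<in> vec.span (residue_code C)"
    unfolding vec.span_insert by blast
  then have "x - b *s residue \<alpha> \<in> residue_code C"
    using vec.span_eq_iff subspace_residue_code[OF subspace] by blast
  then obtain c where c: "c \<in> C" "x - b *s residue \<alpha> = residue c"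
    unfolding residue_code_eq by blast
  obtain k where "dot c \<alpha> = 2 * k" using even_pairing[OF c(1)] by blast
  obtain l where l: "mod2 l = b" by (cases b) (use mod2_0 mod2_1 in blast)+
  let ?c = "c + (l - k) *s t"
  have "?c \<in> C" using c(1) t_in z4.subspace_add[OF subspace] z4.subspace_scale[OF subspace] by blast
  moreover have "dot ?c \<alpha> = 2 * l" by (simp add: dot_t \<open>dot c \<alpha> = 2 * k\<close> algebra_simps)
  ultimately have "?c + l *s \<alpha> \<in> reflected" by (rule reflectedI)
  moreover have "x = residue (?c + l *s \<alpha>)"
  proof -
    have "residue (?c + l *s \<alpha>) = residue c + b *s residue \<alpha>"
      by (simp only: residue_simps residue_t l vec.scale_zero_right add_0_right)
    then show ?thesis using c(2) by (metis diff_add_cancel)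
  qed
  ultimately show "x \<in> residue_code reflected" unfolding residue_code_eq by blast
qed

text \<open>
  The codewords with even \<open>k\<close> form the common subcode; those with odd \<open>k\<close> form its coset of
  \<open>t + \<alpha>\<close>, which is disjoint from \<open>C\<close>.
\<close>

lemma neighbor_reflected: "neighbor (A4 reflected) (A4 C)"
proof -
  have common: "z4.subspace common"
    unfolding common_def
    by (rule z4.subspaceI)
      (use z4.subspace_0[OF subspace] z4.subspace_add[OF subspace] z4.subspace_scale[OF subspace]
        in simp_all)
  have "has_index (A4 C) (A4 common) 2"
    using common common_subset(1) t_in _ common_or_shift
    by (rule has_index_A4_2I) (simp add: common_def dot_t)
  moreover have "has_index (A4 reflected) (A4 common) 2"
  proof (rule has_index_A4_2I[OF common common_subset(2) shift_in_reflected])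
    show "t + \<alpha> \<notin> common"
    proof
      assume "t + \<alpha> \<in> common"
      then have "(t + \<alpha>) - t \<in> C"
        using z4.subspace_diff[OF subspace _ t_in] unfolding common_def by blast
      then show False using \<alpha>_notin by simp
    qed
    fix y assume "y \<in> reflected"
    then obtain c k where y: "y = c + k *s \<alpha>" "c \<in> C" "dot c \<alpha> = 2 * k" by (elim reflectedE)
    have even: "c + (2 * l) *s \<alpha> \<in> common" if "c \<in> common" for c l
      using that even_multiple_in z4.subspace_add[OF subspace] by (auto simp: common_def dot_\<alpha>_\<alpha>)
    consider l where "k = 2 * l" | l where "k = 1 + 2 * l"
      using z4_even_or_odd by blast
    then show "y \<in> common \<or> y - (t + \<alpha>) \<in> common"
    proof cases
      case 1
      then have "c \<in> common" using y(2,3) by (simp add: common_def z4_four_mult)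
      then show ?thesis using even[of c l] by (simp add: y(1) 1)
    next
      case 2
      then have "c - t \<in> common"
        using y(2,3) t_in z4.subspace_diff[OF subspace]
        by (simp add: common_def dot_t z4_four_mult algebra_simps)
      moreover have "y - (t + \<alpha>) = (c - t) + (2 * l) *s \<alpha>"
        by (simp add: y(1) 2 z4.scale_left_distrib)
      ultimately show ?thesis using even[of "c - t" l] by metis
    qed
  qed
  moreover have "A4 common \<subseteq> A4 reflected" "A4 common \<subseteq> A4 C"
    using common_subset by (auto simp: A4_eq)
  ultimately show ?thesis
    unfolding neighbor_def
    using is_lattice_A4[OF subspace] is_lattice_A4[OF subspace_reflected] is_lattice_A4[OF common]
    by blast
qed

end

theorem lemma3p3:
  fixes C :: "(z4 ^ 'n) set" and a :: "bit ^ 'n"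
  assumes "type_II C"
    and "min_euclidean_weight C = 16"
    and "weight a = 4"
    and "a \<notin> residue_code C"
    and "doubly_even (vec.span (insert a (residue_code C)))"
  shows "\<exists>C' :: (z4 ^ 'n) set. type_II C' \<and> min_euclidean_weight C' = 16 \<and>
           residue_code C' = vec.span (insert a (residue_code C)) \<and>
           neighbor (A4 C') (A4 C)"
proof -
  have sub: "z4.subspace C" and self_dual: "C = z4_dual C"
    using assms(1) by (simp_all add: type_II_def z4_self_dual_def)
  define w :: "int ^ 'n" where "w = (\<chi> i. of_bool (a $ i \<noteq> 0))"
  have "dot w w = int (weight a)"
    by (simp add: dot_def w_def weight_def flip: of_bool_conj)
  then have norm_w: "dot w w = 4" using assms(3) by simp
  have "mod2 (of_int (of_bool (p \<noteq> 0))) = p" for p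
    by (cases p) simp_all
  then have residue_w: "residue (red4 w) = a"
    unfolding residue_def red4_def w_def vec_eq_iff vec_lambda_beta by blast

  have even: "\<exists>k. dot c (red4 w) = 2 * k" if "c \<in> C" for c
  proof -
    let ?D = "vec.span (insert a (residue_code C))"
    have "residue c \<in> ?D" "a \<in> ?D"
      using that by (auto simp: residue_code_eq intro: vec.span_base)
    then have "dot (residue c) a = 0"
      using doubly_even_orthogonal[OF assms(5)] vec.span_add by blast
    then have "mod2 (dot c (red4 w)) = 0" using residue_w dot_residue by metis
    then show ?thesis unfolding mod2_eq_0_iff z4_twice_eq_0_iff .
  qed

  \<comment> \<open>The codeword \<open>t = 2b\<close>, for \<open>b\<close> orthogonal to the residue code but not to \<open>a\<close>.\<close>
  obtain b where b: "\<forall>x\<in>residue_code C. dot b x = 0" "dot b a = 1"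
    using separating_vector[OF subspace_residue_code[OF sub] assms(4)] by metis
  define \<beta> :: "z4 ^ 'n" where "\<beta> = (\<chi> i. if b $ i = 0 then 0 else 1)"
  have residue_\<beta>: "residue \<beta> = b"
    by (auto simp: residue_def \<beta>_def vec_eq_iff)
  have "2 *s \<beta> \<in> z4_dual C"
    unfolding z4_dual_def dot_def[symmetric]
  proof (intro CollectI ballI)
    fix c assume "c \<in> C"
    then have "mod2 (dot c \<beta>) = 0"
      using b(1) residue_\<beta> dot_residue[of c \<beta>]
      by (simp add: residue_code_eq dot_commute)
    then show "dot c (2 *s \<beta>) = 0" by (simp add: mod2_eq_0_iff)
  qed
  then have t_in: "2 *s \<beta> \<in> C" using self_dual by blast
  have "mod2 (dot \<beta> (red4 w)) = 1"
    using b(2) residue_w residue_\<beta> dot_residue[of \<beta> "red4 w"] by simp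
  moreover have "2 * z = 2" if "mod2 z = 1" for z
    using that by (cases z rule: z4_cases) simp_all
  ultimately have dot_t: "dot (2 *s \<beta>) (red4 w) = 2" by simp

  interpret odd_reflection C w "2 *s \<beta>"
    by unfold_locales (use assms(1) norm_w even t_in dot_t in simp_all)
  show ?thesis
    using type_II_reflected min_weight_reflected[OF assms(2)] residue_code_reflected
      neighbor_reflected residue_w by metis
qed

end
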